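(* Let $S\subseteq[M]$, $\epsilon>0$ and $p\in\mathcal{P}_S$. For $x\in S^{n-1}$ let $$h_{S,x}=\bigcap_{s\in S}\left\{y\in S^{n-1}:(x-P_{C_s}x)^Ty=0\right\},$$ and let $$C_{S,\epsilon}=\{(x,y)\in\overset{*}{\mathcal{S}}_{S,\epsilon}\times S^{n-1}: d(y,h_{S,x})<\epsilon\},\qquad D_{S,\epsilon}=(\overset{*}{\mathcal{S}}_{S,\epsilon}\times S^{n-1})\setminus C_{S,\epsilon}.$$ Consider $f(S,\cdot,p,\cdot):D_{S,\epsilon}\to\mathbb{R}$ defined by $$f(S,x,p,y)=\sum_{s\in S}p(s)\left\Vert\left(I-\frac{(x-P_{C_s}x)(x-P_{C_s}x)^T}{\Vert x-P_{C_s}x\Vert^2}\right)y\right\Vert^2.$$ Then there is a constant $\alpha(S,p,\epsilon)<1$ such that $f(S,x,p,y)\le\alpha(S,p,\epsilon)<1$ for all $(x,y)\in D_{S,\epsilon}$. Moreover, for every $(x,y)\in D_{S,\epsilon}$ there exists $s(y)\in S$ such that $$\left\Vert\left(I-\frac{(x-P_{C_{s(y)}}x)(x-P_{C_{s(y)}}x)^T}{\Vert x-P_{C_{s(y)}}x\Vert^2}\right)y\right\Vert^2\le\frac{\alpha(S,p,\epsilon)}{|S|\,p(s(y))}.$$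
   Context: $A\in\mathbb{R}^{m\times n}$ and $b\in\mathbb{R}^m$ are partitioned by rows into blocks $A_1,\dots,A_M$ and $b_1,\dots,b_M$; $[M]=\{1,\dots,M\}$. Standing assumption: the system $Ax=b$ is overdetermined and consistent with unique solution $x^*=0$ (so $b=0$). For $i\in[M]$, $C_i=\{x\in\mathbb{R}^n:A_ix=b_i\}$, a linear subspace, and $P_{C_i}$ is the orthogonal projection onto $C_i$. $S^{n-1}$ is the unit sphere of $\mathbb{R}^n$, $\Vert\cdot\Vert$ the Euclidean norm, and $d$ the Euclidean distance from a point to a set, with $d(\cdot,\emptyset)=+\infty$. $\mathcal{P}$ is the set of probability measures on $[M]$, and $\mathcal{P}_S=\{p\in\mathcal{P}:\operatorname{supp}(p)=S\}$. For $S\subseteq[M]$ and $\epsilon>0$, $$B_S=\left\{x\in S^{n-1}:\dim\left(\operatorname{span}\{x-P_{C_s}x\}_{s\in S}\right)<|S|\right\},\quad B_{S,\epsilon}=\{x\in S^{n-1}:d(x,B_S)<\epsilon\},\quad \overset{*}{\mathcal{S}}_{S,\epsilon}=S^{n-1}\setminus B_{S,\epsilon}.$$ *)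

theory Defs
  imports "HOL-Analysis.Analysis" "HOL-Probability.Probability_Mass_Function"
begin

(* R i is the set of row indices belonging to the i-th block, i = 1, ..., M. *)
definition row_partition :: "nat \<Rightarrow> (nat \<Rightarrow> 'm set) \<Rightarrow> bool" where
  "row_partition M R \<longleftrightarrow>
     (\<forall>i\<in>{1..M}. R i \<noteq> {}) \<and> disjoint_family_on R {1..M} \<and> (\<Union>i\<in>{1..M}. R i) = UNIV"

(* C_i = {x. A_i x = b_i}; the block system is stated row by row, because the number of rows of
   A_i varies with i. *)
definition block_solutions :: "real^'n^'m \<Rightarrow> real^'m \<Rightarrow> (nat \<Rightarrow> 'm set) \<Rightarrow> nat \<Rightarrow> (real^'n) set" where
  "block_solutions A b R i = {x. \<forall>r\<in>R i. (A *v x) $ r = b $ r}"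

(* x - P_C x. The library's closest_point is the metric projection; closest_point_orthogonal_iff
   below shows that on a subspace it is the orthogonal projection. *)
definition proj_residual :: "(real^'n) set \<Rightarrow> real^'n \<Rightarrow> real^'n" where
  "proj_residual C x = x - closest_point C x"

lemma closest_point_orthogonal_iff:
  fixes C :: "'a::euclidean_space set"
  assumes "subspace C"
  shows "closest_point C x = q \<longleftrightarrow> q \<in> C \<and> (\<forall>z\<in>C. orthogonal (x - q) z)"
proof
  assume q: "closest_point C x = q"
  have cvx: "convex C" and cl: "closed C" and ne: "C \<noteq> {}"
    using assms by (auto simp: subspace_imp_convex closed_subspace dest: subspace_0)
  have qC: "q \<in> C"
    using closest_point_in_set[OF cl ne] q by metis
  have "(x - q) \<bullet> z \<le> 0" if "z \<in> C" for z
    using closest_point_dot[OF cvx cl, of "q + z" x] q subspace_add[OF assms qC that] by simp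
  then have le: "(x - q) \<bullet> z \<le> 0 \<and> (x - q) \<bullet> (- z) \<le> 0" if "z \<in> C" for z
    using that subspace_neg[OF assms that] by blast
  have "(x - q) \<bullet> z = 0" if "z \<in> C" for z
    using le[OF that] by (simp add: inner_minus_right)
  then show "q \<in> C \<and> (\<forall>z\<in>C. orthogonal (x - q) z)"
    using qC by (simp add: orthogonal_def)
next
  assume q: "q \<in> C \<and> (\<forall>z\<in>C. orthogonal (x - q) z)"
  have "dist x q \<le> dist x z" if z: "z \<in> C" for z
  proof -
    have "orthogonal (x - q) (q - z)"
      using q subspace_diff[OF assms, of q z] z by blast
    then have "(norm ((x - q) + (q - z)))\<^sup>2 = (norm (x - q))\<^sup>2 + (norm (q - z))\<^sup>2"
      by (rule norm_add_Pythagorean)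
    then have "(norm (x - q))\<^sup>2 \<le> (norm (x - z))\<^sup>2"
      by simp
    then show ?thesis
      by (simp add: dist_norm power2_le_iff_abs_le)
  qed
  then have "q = closest_point C x"
    using q assms by (intro closest_point_unique)
      (auto simp: subspace_imp_convex closed_subspace)
  then show "closest_point C x = q" by simp
qed

(* Distance to a set, with value \<infinity> for the empty set (the library's infdist gives 0 there). *)
definition set_dist :: "'a::metric_space \<Rightarrow> 'a set \<Rightarrow> ereal" where
  "set_dist x X = (INF a\<in>X. ereal (dist x a))"

definition prob_measures :: "nat \<Rightarrow> nat pmf set" where
  "prob_measures M = {p. set_pmf p \<subseteq> {1..M}}"

definition prob_measures_supp :: "nat \<Rightarrow> nat set \<Rightarrow> nat pmf set" where
  "prob_measures_supp M S = {p \<in> prob_measures M. set_pmf p = S}"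

(* From here on C stands for the family of sets C_1, ..., C_M. *)

definition bad_set :: "(nat \<Rightarrow> (real^'n) set) \<Rightarrow> nat set \<Rightarrow> (real^'n) set" where
  "bad_set C S = {x \<in> sphere 0 1. dim (span ((\<lambda>s. proj_residual (C s) x) ` S)) < card S}"

definition bad_nbhd :: "(nat \<Rightarrow> (real^'n) set) \<Rightarrow> nat set \<Rightarrow> real \<Rightarrow> (real^'n) set" where
  "bad_nbhd C S \<epsilon> = {x \<in> sphere 0 1. set_dist x (bad_set C S) < ereal \<epsilon>}"

definition good_sphere :: "(nat \<Rightarrow> (real^'n) set) \<Rightarrow> nat set \<Rightarrow> real \<Rightarrow> (real^'n) set" where
  "good_sphere C S \<epsilon> = sphere 0 1 - bad_nbhd C S \<epsilon>"

definition h_set :: "(nat \<Rightarrow> (real^'n) set) \<Rightarrow> nat set \<Rightarrow> real^'n \<Rightarrow> (real^'n) set" where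
  "h_set C S x = (\<Inter>s\<in>S. {y \<in> sphere 0 1. proj_residual (C s) x \<bullet> y = 0})"

definition C_pairs :: "(nat \<Rightarrow> (real^'n) set) \<Rightarrow> nat set \<Rightarrow> real \<Rightarrow> ((real^'n) \<times> (real^'n)) set" where
  "C_pairs C S \<epsilon> = {(x, y) \<in> good_sphere C S \<epsilon> \<times> sphere 0 1. set_dist y (h_set C S x) < ereal \<epsilon>}"

definition D_pairs :: "(nat \<Rightarrow> (real^'n) set) \<Rightarrow> nat set \<Rightarrow> real \<Rightarrow> ((real^'n) \<times> (real^'n)) set" where
  "D_pairs C S \<epsilon> = (good_sphere C S \<epsilon> \<times> sphere 0 1) - C_pairs C S \<epsilon>"

(* The matrix I - v v^T / |v|^2; the type annotations make the column n x 1 and the row 1 x n. *)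
definition rank_one_compl :: "real^'n \<Rightarrow> real^'n^'n" where
  "rank_one_compl v =
     mat 1 - ((columnvector v :: real^1^'n) ** (rowvector v :: real^'n^1)) /\<^sub>R (norm v)\<^sup>2"

definition f_sum :: "(nat \<Rightarrow> (real^'n) set) \<Rightarrow> nat set \<Rightarrow> real^'n \<Rightarrow> nat pmf \<Rightarrow> real^'n \<Rightarrow> real" where
  "f_sum C S x p y =
     (\<Sum>s\<in>S. pmf p s * (norm (rank_one_compl (proj_residual (C s) x) *v y))\<^sup>2)"

end

theory Submission
  imports Defs
begin

text \<open>
  Write \<open>v\<^sub>s(x) = x - P\<^bsub>C\<^sub>s\<^esub> x\<close>. By Pythagoras, on unit vectors \<open>y\<close>
    \<open>f(S, x, p, y) = 1 - (\<Sum>s. p(s) (v\<^sub>s(x) \<bullet> y)\<^sup>2 / \<parallel>v\<^sub>s(x)\<parallel>\<^sup>2)\<close>,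
  where \<open>\<parallel>v\<^sub>s(x)\<parallel> \<le> 1\<close> and \<open>p(s) > 0\<close> for \<open>s \<in> S\<close>. So \<open>f\<close> stays away from \<open>1\<close> as soon as some \<open>\<bar>v\<^sub>s(x) \<bullet> y\<bar>\<close> exceeds a
  threshold \<open>m > 0\<close> that is the same for all pairs of \<open>D\<close>.

  The threshold comes from quantitative linear independence. The good part of the sphere is
  compact, the residuals \<open>v\<^sub>s(x)\<close> depend continuously on \<open>x\<close> and are linearly independent at
  every good \<open>x\<close>; hence there is one \<open>c > 0\<close> with
  \<open>c (\<Sum>s. \<bar>a\<^sub>s\<bar>) \<le> \<parallel>\<Sum>s. a\<^sub>s v\<^sub>s(x)\<parallel>\<close> for all good \<open>x\<close> and all coefficients \<open>a\<close>
  (\<open>uniform_independence_on_compact\<close>). If now every \<open>\<bar>v\<^sub>s(x) \<bullet> y\<bar>\<close> is at most \<open>m\<close>, then the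
  component of \<open>y\<close> in the span of the residuals has norm at most \<open>m / c\<close>; deleting it and
  rescaling moves \<open>y\<close> by at most \<open>2 m / c\<close> and lands in \<open>h\<^bsub>S,x\<^esub>\<close>
  (\<open>nearly_orthogonal_unit_vector\<close>). For small \<open>m\<close> this contradicts that \<open>y\<close> has distance at
  least \<open>\<epsilon>\<close> from \<open>h\<^bsub>S,x\<^esub>\<close>.

  The second claim holds because one of the \<open>|S|\<close> summands of \<open>f\<close> is at most their average.
\<close>

section \<open>Uniform linear independence over a compact set\<close>

lemma independent_family_if_card_le_dim:
  fixes v :: "'i \<Rightarrow> 'v::euclidean_space"
  assumes "finite S" and "card S \<le> dim (v ` S)"
  shows "inj_on v S" and "independent (v ` S)"
proof -
  have "dim (v ` S) \<le> card (v ` S)" and "card (v ` S) \<le> card S"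
    using assms(1) by (auto intro: dim_le_card' card_image_le)
  then have *: "card (v ` S) = card S" "card (v ` S) \<le> dim (v ` S)"
    using assms(2) by auto
  from *(1) show "inj_on v S"
    using assms(1) by (simp add: eq_card_imp_inj_on)
  from *(2) show "independent (v ` S)"
    by (rule card_le_dim_spanning[OF subset_refl span_superset finite_imageI[OF assms(1)]])
qed

lemma sum_scaleR_eq_0_imp_coefficients_0:
  assumes "finite S" and "inj_on v S" and "independent (v ` S)"
    and "(\<Sum>s\<in>S. a s *\<^sub>R v s) = 0" and "s \<in> S"
  shows "a s = 0"
proof -
  have "(\<Sum>w\<in>v ` S. a (inv_into S v w) *\<^sub>R w) = (\<Sum>s\<in>S. a s *\<^sub>R v s)"
    using assms(2) by (simp add: sum.reindex)
  then have "a (inv_into S v (v s)) = 0"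
    using assms by (intro independentD[of "v ` S" "v ` S"]) auto
  then show ?thesis using assms by simp
qed

text \<open>Coefficient families are functions on the whole index type; Tychonoff's theorem makes the
  cube \<open>[-1, 1]\<^sup>I\<close> compact even when \<open>I\<close> is infinite.\<close>

lemma compact_coefficient_sphere:
  fixes S :: "'i set"
  shows "compact {a :: 'i \<Rightarrow> real. (\<forall>i. a i \<in> {-1..1}) \<and> (\<Sum>s\<in>S. \<bar>a s\<bar>) = 1}"
proof -
  have "compactin (product_topology (\<lambda>_. euclidean) UNIV) (PiE (UNIV :: 'i set) (\<lambda>_. {-1..1::real}))"
    by (subst compactin_PiE) auto
  then have "compact {a :: 'i \<Rightarrow> real. \<forall>i. a i \<in> {-1..1}}"
    by (simp add: euclidean_product_topology PiE_UNIV_domain Pi_def)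
  moreover have "closed {a :: 'i \<Rightarrow> real. (\<Sum>s\<in>S. \<bar>a s\<bar>) = 1}"
    by (intro closed_Collect_eq continuous_intros continuous_on_product_coordinates)
  ultimately show ?thesis
    by (simp add: Collect_conj_eq compact_Int_closed)
qed

text \<open>By homogeneity it suffices to treat coefficients with \<open>\<Sum>s. \<bar>a\<^sub>s\<bar> = 1\<close>; on the compact set of
  pairs \<open>(x, a)\<close> the norm of the combination attains its minimum, which is positive by
  independence.\<close>

lemma uniform_independence_on_compact:
  fixes v :: "'i \<Rightarrow> 'x::topological_space \<Rightarrow> 'v::real_normed_vector"
  assumes S: "finite S" and K: "compact K"
    and cont: "\<And>s. s \<in> S \<Longrightarrow> continuous_on K (v s)"
    and inj: "\<And>x. x \<in> K \<Longrightarrow> inj_on (\<lambda>s. v s x) S"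
    and indep: "\<And>x. x \<in> K \<Longrightarrow> independent ((\<lambda>s. v s x) ` S)"
  shows "\<exists>c>0. \<forall>x\<in>K. \<forall>a. c * (\<Sum>s\<in>S. \<bar>a s\<bar>) \<le> norm (\<Sum>s\<in>S. a s *\<^sub>R v s x)"
proof (cases "K = {} \<or> S = {}")
  case True
  then show ?thesis by (auto intro: exI[of _ 1])
next
  case False
  define T where "T = {a :: 'i \<Rightarrow> real. (\<forall>i. a i \<in> {-1..1}) \<and> (\<Sum>s\<in>S. \<bar>a s\<bar>) = 1}"
  define g where "g = (\<lambda>(x, a). norm (\<Sum>s\<in>S. a s *\<^sub>R v s x))"
  have "compact (K \<times> T)"
    using K unfolding T_def by (intro compact_Times compact_coefficient_sphere)
  moreover have "K \<times> T \<noteq> {}"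
  proof -
    obtain s where "s \<in> S" using False by auto
    then have "(\<lambda>i. if i = s then 1 else 0) \<in> T"
      using S by (simp add: T_def if_distrib cong: if_cong)
    then show ?thesis using False by auto
  qed
  moreover have "continuous_on (K \<times> T) g"
    unfolding g_def case_prod_beta
    by (intro continuous_intros continuous_on_compose2[OF cont]
          continuous_on_compose2[OF continuous_on_product_coordinates]) auto
  ultimately obtain q where q: "q \<in> K \<times> T" and min: "\<And>r. r \<in> K \<times> T \<Longrightarrow> g q \<le> g r"
    using continuous_attains_inf[of "K \<times> T" g] by blast
  have "g q \<noteq> 0"
  proof
    assume "g q = 0"
    obtain x a where xa: "q = (x, a)" "x \<in> K" "a \<in> T" using q by auto
    then have "(\<Sum>s\<in>S. a s *\<^sub>R v s x) = 0" using \<open>g q = 0\<close> by (simp add: g_def)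
    then have "\<forall>s\<in>S. a s = 0"
      using sum_scaleR_eq_0_imp_coefficients_0[OF S inj[OF xa(2)] indep[OF xa(2)], of a] by simp
    then show False using xa(3) by (simp add: T_def)
  qed
  then have "g q > 0" by (auto simp: g_def split: prod.splits)
  moreover have "g q * (\<Sum>s\<in>S. \<bar>a s\<bar>) \<le> norm (\<Sum>s\<in>S. a s *\<^sub>R v s x)" if x: "x \<in> K" for x a
  proof (cases "(\<Sum>s\<in>S. \<bar>a s\<bar>) = 0")
    case False
    define L where "L = (\<Sum>s\<in>S. \<bar>a s\<bar>)"
    have L: "L > 0" using False by (simp add: L_def sum_nonneg less_le)
    \<comment> \<open>Extension by \<open>0\<close> outside \<open>S\<close> keeps the rescaled coefficients in the cube.\<close>
    define a' where "a' = (\<lambda>i. if i \<in> S then a i / L else 0)"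
    have "\<bar>a s\<bar> \<le> L" if "s \<in> S" for s
      unfolding L_def using that S by (intro member_le_sum) auto
    then have "\<forall>i. \<bar>a' i\<bar> \<le> 1" using L by (simp add: a'_def)
    moreover have "(\<Sum>s\<in>S. \<bar>a' s\<bar>) = 1"
      using L by (simp add: a'_def L_def flip: sum_divide_distrib)
    ultimately have "a' \<in> T" by (auto simp: T_def abs_le_iff minus_le_iff)
    then have "g q \<le> norm (\<Sum>s\<in>S. a' s *\<^sub>R v s x)" using min[of "(x, a')"] x by (simp add: g_def)
    also have "(\<Sum>s\<in>S. a' s *\<^sub>R v s x) = (1 / L) *\<^sub>R (\<Sum>s\<in>S. a s *\<^sub>R v s x)"
      by (simp add: a'_def scaleR_sum_right divide_inverse mult.commute)
    finally show ?thesis using L by (simp add: L_def[symmetric] field_simps)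
  qed simp
  ultimately show ?thesis by blast
qed

section \<open>Vectors nearly orthogonal to a family\<close>

text \<open>If \<open>w = \<Sum>s. a\<^sub>s v\<^sub>s\<close> is the component of \<open>y\<close> in the span, then
  \<open>\<parallel>w\<parallel>\<^sup>2 = w \<bullet> y = \<Sum>s. a\<^sub>s (v\<^sub>s \<bullet> y) \<le> m (\<Sum>s. \<bar>a\<^sub>s\<bar>) \<le> (m / c) \<parallel>w\<parallel>\<close>, so \<open>w\<close> is short and \<open>y - w\<close>
  is almost a unit vector, which normalization moves by at most another \<open>\<parallel>w\<parallel>\<close>.\<close>

lemma nearly_orthogonal_unit_vector:
  fixes v :: "'i \<Rightarrow> 'v::euclidean_space"
  assumes S: "finite S" and inj: "inj_on v S" and c: "c > 0"
    and lower: "\<And>a. c * (\<Sum>s\<in>S. \<bar>a s\<bar>) \<le> norm (\<Sum>s\<in>S. a s *\<^sub>R v s)"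
    and y: "norm y = 1" and small: "\<And>s. s \<in> S \<Longrightarrow> \<bar>v s \<bullet> y\<bar> \<le> m" and m: "0 \<le> m" "m < c"
  shows "\<exists>z. norm z = 1 \<and> (\<forall>s\<in>S. v s \<bullet> z = 0) \<and> dist y z \<le> 2 * m / c"
proof -
  obtain w u where w: "w \<in> span (v ` S)" and u: "\<And>t. t \<in> span (v ` S) \<Longrightarrow> orthogonal u t"
    and ywu: "y = w + u"
    using orthogonal_subspace_decomp_exists[of "v ` S" y] by metis
  obtain a' where "w = (\<Sum>t\<in>v ` S. a' t *\<^sub>R t)"
    using w span_finite[of "v ` S"] S by auto
  then have "w = (\<Sum>s\<in>S. a' (v s) *\<^sub>R v s)"
    using inj by (simp add: sum.reindex)
  then obtain a where a: "w = (\<Sum>s\<in>S. a s *\<^sub>R v s)"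
    by (rule that)
  have "(norm w)\<^sup>2 = w \<bullet> y"
    using u[OF w] by (simp add: ywu power2_norm_eq_inner inner_add_right orthogonal_def inner_commute)
  also have "\<dots> = (\<Sum>s\<in>S. a s * (v s \<bullet> y))"
    by (simp add: a inner_sum_left)
  also have "\<dots> \<le> (\<Sum>s\<in>S. \<bar>a s\<bar> * m)"
  proof (rule sum_mono)
    fix s assume "s \<in> S"
    have "a s * (v s \<bullet> y) \<le> \<bar>a s\<bar> * \<bar>v s \<bullet> y\<bar>"
      by (metis abs_ge_self abs_mult)
    also have "\<dots> \<le> \<bar>a s\<bar> * m"
      using small[OF \<open>s \<in> S\<close>] by (intro mult_left_mono) auto
    finally show "a s * (v s \<bullet> y) \<le> \<bar>a s\<bar> * m" .
  qed
  also have "\<dots> \<le> norm w / c * m"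
  proof -
    have "(\<Sum>s\<in>S. \<bar>a s\<bar>) \<le> norm w / c"
      using lower[of a] c by (simp add: a pos_le_divide_eq mult.commute)
    then show ?thesis
      unfolding sum_distrib_right[symmetric] using m(1) by (rule mult_right_mono)
  qed
  finally have "norm w * norm w \<le> norm w * (m / c)"
    by (simp add: power2_eq_square)
  then have wm: "norm w \<le> m / c"
    using c m(1) mult_le_cancel_left_pos[of "norm w" "norm w" "m / c"] by (cases "w = 0") simp_all
  then have "norm w < 1"
    using c m(2) by (meson divide_less_eq_1_pos le_less_trans)
  then have u0: "u \<noteq> 0"
    using y ywu by auto
  show ?thesis
  proof (intro exI[of _ "u /\<^sub>R norm u"] conjI ballI)
    show "norm (u /\<^sub>R norm u) = 1" using u0 by simp
    show "v s \<bullet> (u /\<^sub>R norm u) = 0" if "s \<in> S" for s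
      using u[of "v s"] that by (simp add: span_base orthogonal_def inner_commute)
    have "u - u /\<^sub>R norm u = (norm u - 1) *\<^sub>R (u /\<^sub>R norm u)"
      using u0 by (simp add: algebra_simps)
    then have "norm (u - u /\<^sub>R norm u) = \<bar>norm u - 1\<bar> * norm (u /\<^sub>R norm u)"
      by (simp only: norm_scaleR)
    then have "norm (u - u /\<^sub>R norm u) = \<bar>norm u - norm y\<bar>"
      using u0 y by simp
    also have "\<dots> \<le> norm (u - y)"
      by (rule norm_triangle_ineq3)
    finally have "norm (u - u /\<^sub>R norm u) \<le> norm w" by (simp add: ywu)
    then have "norm (w + (u - u /\<^sub>R norm u)) \<le> 2 * norm w"
      using norm_triangle_ineq[of w "u - u /\<^sub>R norm u"] by linarith
    then show "dist y (u /\<^sub>R norm u) \<le> 2 * m / c"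
      using wm by (simp add: dist_norm ywu add_diff_eq)
  qed
qed

section \<open>The residuals on the good part of the sphere\<close>

lemma set_dist_less_iff:
  "set_dist x X < ereal e \<longleftrightarrow> (\<exists>a\<in>X. dist x a < e)"
  by (simp add: set_dist_def INF_less_iff)

lemma compact_good_sphere: "compact (good_sphere C S \<epsilon>)"
proof -
  have "good_sphere C S \<epsilon> = sphere 0 1 \<inter> (\<Inter>a\<in>bad_set C S. {x. \<epsilon> \<le> dist x a})"
    by (auto simp: good_sphere_def bad_nbhd_def set_dist_less_iff simp flip: not_less)
  moreover have "closed (\<Inter>a\<in>bad_set C S. {x. \<epsilon> \<le> dist x a})"
    by (intro closed_INT ballI closed_Collect_le continuous_intros)
  ultimately show ?thesis
    by (simp add: compact_Int_closed)
qed

lemma good_sphere_residuals_independent: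
  assumes "x \<in> good_sphere C S \<epsilon>" and "\<epsilon> > 0" and "finite S"
  shows "inj_on (\<lambda>s. proj_residual (C s) x) S"
    and "independent ((\<lambda>s. proj_residual (C s) x) ` S)"
proof -
  have "x \<notin> bad_set C S" and "x \<in> sphere 0 1"
    using assms(1,2) by (auto simp: good_sphere_def bad_nbhd_def set_dist_less_iff)
  then have "card S \<le> dim ((\<lambda>s. proj_residual (C s) x) ` S)"
    by (simp add: bad_set_def not_less)
  then show "inj_on (\<lambda>s. proj_residual (C s) x) S"
    and "independent ((\<lambda>s. proj_residual (C s) x) ` S)"
    using independent_family_if_card_le_dim[OF assms(3)] by blast+
qed

lemma norm_proj_residual_le:
  assumes "subspace C"
  shows "norm (proj_residual C x) \<le> norm x"
  using closest_point_le[OF closed_subspace[OF assms] subspace_0[OF assms], of x]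
  by (simp add: proj_residual_def dist_norm)

lemma continuous_on_proj_residual:
  assumes "subspace C"
  shows "continuous_on K (proj_residual C)"
  unfolding proj_residual_def
  using assms subspace_0[OF assms]
  by (intro continuous_intros continuous_on_closest_point)
     (auto simp: subspace_imp_convex closed_subspace)

lemma subspace_block_solutions_0: "subspace (block_solutions A 0 R i)"
  by (auto simp: subspace_def block_solutions_def matrix_vector_right_distrib
        matrix_vector_mult_scaleR)

lemma rank_one_compl_mult_vector:
  fixes v y :: "real^'n"
  shows
  "rank_one_compl v *v y = y - ((v \<bullet> y) / (norm v)\<^sup>2) *\<^sub>R v"
proof -
  have "((columnvector v :: real^1^'n) ** (rowvector v :: real^'n^1)) *v y = (v \<bullet> y) *\<^sub>R v"
    by (simp add: vec_eq_iff matrix_vector_mult_def matrix_matrix_mult_def columnvector_def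
          rowvector_def inner_vec_def sum_distrib_right sum_distrib_left mult_ac)
  then show ?thesis
    by (simp add: rank_one_compl_def matrix_vector_mult_diff_rdistrib
          scaleR_matrix_vector_assoc[symmetric] divide_inverse mult.commute)
qed

lemma norm_rank_one_compl_squared:
  fixes v y :: "real^'n"
  shows
  "(norm (rank_one_compl v *v y))\<^sup>2 = (norm y)\<^sup>2 - (v \<bullet> y)\<^sup>2 / (norm v)\<^sup>2"
proof (cases "v = 0")
  case False
  define t where "t = (v \<bullet> y) / (norm v)\<^sup>2"
  have "t * (norm v)\<^sup>2 = v \<bullet> y" using False by (simp add: t_def)
  moreover have "(norm (y - t *\<^sub>R v))\<^sup>2 = (norm y)\<^sup>2 - 2 * t * (v \<bullet> y) + t * (t * (norm v)\<^sup>2)"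
    by (simp add: power2_norm_eq_inner algebra_simps inner_commute)
  ultimately have "(norm (y - t *\<^sub>R v))\<^sup>2 = (norm y)\<^sup>2 - t * (v \<bullet> y)"
    by simp
  then show ?thesis
    by (simp add: rank_one_compl_mult_vector t_def power2_eq_square)
qed (simp add: rank_one_compl_mult_vector)

text \<open>This is where the two \<open>\<epsilon>\<close>-exclusions in \<open>D\<close> meet: the first makes the residuals uniformly
  independent, so that a pair with all inner products small would violate the second.\<close>

lemma D_pairs_inner_bounded_below:
  fixes C :: "nat \<Rightarrow> (real^'n) set"
  assumes S: "finite S" "S \<noteq> {}" and sub: "\<And>s. s \<in> S \<Longrightarrow> subspace (C s)" and \<epsilon>: "\<epsilon> > 0"
  shows "\<exists>m>0. \<forall>(x, y)\<in>D_pairs C S \<epsilon>. \<exists>s\<in>S. m < \<bar>proj_residual (C s) x \<bullet> y\<bar>"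
proof -
  have "\<exists>c>0. \<forall>x\<in>good_sphere C S \<epsilon>. \<forall>a.
      c * (\<Sum>s\<in>S. \<bar>a s\<bar>) \<le> norm (\<Sum>s\<in>S. a s *\<^sub>R proj_residual (C s) x)"
    by (intro uniform_independence_on_compact S(1) compact_good_sphere
          continuous_on_proj_residual sub good_sphere_residuals_independent[OF _ \<epsilon> S(1)])
  then obtain c where c: "c > 0" and lower: "\<And>x a. x \<in> good_sphere C S \<epsilon> \<Longrightarrow>
      c * (\<Sum>s\<in>S. \<bar>a s\<bar>) \<le> norm (\<Sum>s\<in>S. a s *\<^sub>R proj_residual (C s) x)"
    by blast
  \<comment> \<open>Any \<open>m\<close> with \<open>m < c\<close> and \<open>2 m / c < \<epsilon>\<close> would do.\<close>
  define m where "m = c * (min 1 \<epsilon> / 3)"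
  have m: "m > 0" "m < c" "2 * m / c < \<epsilon>"
    using c \<epsilon> by (auto simp: m_def min_def)
  have "\<exists>s\<in>S. m < \<bar>proj_residual (C s) x \<bullet> y\<bar>" if D: "(x, y) \<in> D_pairs C S \<epsilon>" for x y
  proof (rule ccontr)
    assume "\<not> ?thesis"
    then have small: "\<And>s. s \<in> S \<Longrightarrow> \<bar>proj_residual (C s) x \<bullet> y\<bar> \<le> m"
      by (simp add: not_less)
    have x: "x \<in> good_sphere C S \<epsilon>" and y: "norm y = 1"
      and far: "\<And>z. z \<in> h_set C S x \<Longrightarrow> \<epsilon> \<le> dist y z"
      using D by (auto simp: D_pairs_def C_pairs_def set_dist_less_iff not_less)
    obtain z where "norm z = 1" "\<forall>s\<in>S. proj_residual (C s) x \<bullet> z = 0" "dist y z \<le> 2 * m / c"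
      using nearly_orthogonal_unit_vector[OF S(1)
          good_sphere_residuals_independent(1)[OF x \<epsilon> S(1)] c lower[OF x] y small
          less_imp_le[OF m(1)] m(2)] by blast
    then have "z \<in> h_set C S x" and "dist y z < \<epsilon>"
      using m(3) by (auto simp: h_set_def)
    then show False using far by fastforce
  qed
  with m(1) show ?thesis by blast
qed

section \<open>The bound for the weighted sum\<close>

lemma exists_summand_le_average:
  fixes g :: "'i \<Rightarrow> real"
  assumes "finite S" and "S \<noteq> {}" and "sum g S \<le> \<alpha>"
  shows "\<exists>s\<in>S. g s \<le> \<alpha> / real (card S)"
proof (rule ccontr)
  assume "\<not> ?thesis"
  then have "(\<Sum>s\<in>S. \<alpha> / real (card S)) < sum g S"
    using assms by (intro sum_strict_mono) auto
  then show False using assms by simp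
qed

theorem theorem4:
  fixes A :: "real^'n^'m" and b :: "real^'m" and M :: nat and R :: "nat \<Rightarrow> 'm set"
    and C :: "nat \<Rightarrow> (real^'n) set" and S :: "nat set" and \<epsilon> :: real and p :: "nat pmf"
  assumes "row_partition M R"
    and "CARD('n) < CARD('m)"
    and "\<And>x. A *v x = b \<longleftrightarrow> x = 0"
    and "\<And>i. i \<in> {1..M} \<Longrightarrow> C i = block_solutions A b R i"
    and "S \<subseteq> {1..M}"
    and "\<epsilon> > 0"
    and "p \<in> prob_measures_supp M S"
  shows "\<exists>\<alpha> < 1.
    (\<forall>(x, y) \<in> D_pairs C S \<epsilon>. f_sum C S x p y \<le> \<alpha>) \<and>
    (\<forall>(x, y) \<in> D_pairs C S \<epsilon>. \<exists>s \<in> S.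
       (norm (rank_one_compl (proj_residual (C s) x) *v y))\<^sup>2 \<le> \<alpha> / (real (card S) * pmf p s))"
proof -
  have b: "b = 0" using assms(3)[of 0] by simp
  have supp: "set_pmf p = S" using assms(7) by (simp add: prob_measures_supp_def)
  have S: "finite S" "S \<noteq> {}"
    using assms(5) finite_subset supp set_pmf_not_empty[of p] by auto
  have sub: "subspace (C s)" if "s \<in> S" for s
    using assms(4)[of s] assms(5) that by (auto simp: b subspace_block_solutions_0)
  have ppos: "pmf p s > 0" if "s \<in> S" for s
    using that supp by (simp add: pmf_positive)
  have psum: "(\<Sum>s\<in>S. pmf p s) = 1"
    using sum_pmf_eq_1[OF S(1)] supp by simp
  obtain m where m: "m > 0"
    and large: "\<And>x y. (x, y) \<in> D_pairs C S \<epsilon> \<Longrightarrow> \<exists>s\<in>S. m < \<bar>proj_residual (C s) x \<bullet> y\<bar>"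
    using D_pairs_inner_bounded_below[of S C \<epsilon>] S sub assms(6) by blast
  define p0 where "p0 = Min (pmf p ` S)"
  have p0: "p0 > 0" using S ppos by (simp add: p0_def)
  define \<alpha> where "\<alpha> = 1 - p0 * m\<^sup>2"
  have f_le: "f_sum C S x p y \<le> \<alpha>" if D: "(x, y) \<in> D_pairs C S \<epsilon>" for x y
  proof -
    have x: "norm x = 1" and y: "norm y = 1"
      using D by (auto simp: D_pairs_def good_sphere_def)
    define g where "g = (\<lambda>s. (proj_residual (C s) x \<bullet> y)\<^sup>2 / (norm (proj_residual (C s) x))\<^sup>2)"
    obtain s where s: "s \<in> S" and ms: "m < \<bar>proj_residual (C s) x \<bullet> y\<bar>"
      using large[OF D] by auto
    have "p0 * m\<^sup>2 \<le> pmf p s * g s"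
    proof (rule mult_mono)
      have r0: "proj_residual (C s) x \<noteq> 0" using ms m by auto
      have "m\<^sup>2 \<le> (proj_residual (C s) x \<bullet> y)\<^sup>2"
        using ms m by (metis less_imp_le power2_abs power_mono)
      also have "\<dots> / 1 \<le> g s"
        unfolding g_def
        using norm_proj_residual_le[OF sub[OF s], of x] x r0
        by (intro divide_left_mono) (auto simp: power_le_one)
      finally show "m\<^sup>2 \<le> g s" by simp
      show "p0 \<le> pmf p s" using s S by (simp add: p0_def)
    qed auto
    also have "\<dots> \<le> (\<Sum>s\<in>S. pmf p s * g s)"
      using s S by (intro member_le_sum) (auto simp: g_def)
    finally have "p0 * m\<^sup>2 \<le> (\<Sum>s\<in>S. pmf p s * g s)" .
    moreover have "f_sum C S x p y = 1 - (\<Sum>s\<in>S. pmf p s * g s)"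
      by (simp add: f_sum_def norm_rank_one_compl_squared y g_def right_diff_distrib
            sum_subtractf psum)
    ultimately show ?thesis by (simp add: \<alpha>_def)
  qed
  moreover have "\<exists>s\<in>S. (norm (rank_one_compl (proj_residual (C s) x) *v y))\<^sup>2
      \<le> \<alpha> / (real (card S) * pmf p s)" if D: "(x, y) \<in> D_pairs C S \<epsilon>" for x y
  proof -
    obtain s where s: "s \<in> S"
      and le: "pmf p s * (norm (rank_one_compl (proj_residual (C s) x) *v y))\<^sup>2 \<le> \<alpha> / real (card S)"
      using exists_summand_le_average[OF S f_le[OF D, unfolded f_sum_def]] by auto
    have "(norm (rank_one_compl (proj_residual (C s) x) *v y))\<^sup>2 \<le> \<alpha> / real (card S) / pmf p s"
      using le unfolding pos_le_divide_eq[OF ppos[OF s]] by (simp add: mult.commute)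
    then show ?thesis using s by auto
  qed
  moreover have "\<alpha> < 1" using p0 m by (simp add: \<alpha>_def)
  ultimately show ?thesis by blast
qed

end
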